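(* For all integers $d\ge 1$ and $n\ge d$, $$M_n^2(S^{d-1})=\frac nd .$$ Moreover, the extremal configurations, i.e. the multisets $\omega_n=\{u_1,\dots,u_n\}\subset S^{d-1}$ with $M^2(\omega_n)=M_n^2(S^{d-1})$, are exactly the isotropic sets of $n$ unit vectors in $\mathbb{R}^d$.
   Context: $S^{d-1}$ is the Euclidean unit sphere in $\mathbb{R}^d$ and $\langle\cdot,\cdot\rangle$ is the standard inner product. For a multiset $\omega_n=\{u_1,\dots,u_n\}$ of $n$ unit vectors in $\mathbb{R}^d$ (repetitions allowed), $M^2(\omega_n)=\max_{v\in S^{d-1}}\sum_{i=1}^n\langle v,u_i\rangle^2$, and $M_n^2(S^{d-1})=\min_{\omega_n\subset S^{d-1}}M^2(\omega_n)$, the minimum being over all such $n$-element multisets. The multiset $\omega_n=\{u_1,\dots,u_n\}\subset S^{d-1}$ is an isotropic set of unit vectors if $$\sum_{i=1}^n u_i\otimes u_i=\frac nd I_d,$$ where $u\otimes v=uv^\top$ and $I_d$ is the identity operator on $\mathbb{R}^d$. *)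

theory Defs
  imports "HOL-Analysis.Analysis" "HOL-Library.Multiset"
begin

text \<open>The dimension \<open>d\<close> is \<open>CARD('d)\<close>, and \<open>S\<^sup>d\<^sup>-\<^sup>1\<close> is \<open>sphere 0 1\<close> in \<open>real ^ 'd\<close>.\<close>

definition configs :: "nat \<Rightarrow> (real ^ 'd) multiset set" where
  "configs n = {\<omega>. size \<omega> = n \<and> set_mset \<omega> \<subseteq> sphere 0 1}"

text \<open>The supremum is a maximum, see \<open>M2_attained\<close> and \<open>M2_upper\<close> below.\<close>

definition M2 :: "(real ^ 'd) multiset \<Rightarrow> real" where
  "M2 \<omega> = (SUP v \<in> sphere 0 1. \<Sum>u\<in>#\<omega>. (v \<bullet> u)\<^sup>2)"

text \<open>The type argument carries the dimension. That this infimum is attained is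
  not built into the definition; it has to be claimed separately.\<close>

definition M2_min :: "'d::finite itself \<Rightarrow> nat \<Rightarrow> real" where
  "M2_min _ n = (INF \<omega> \<in> (configs n :: (real ^ 'd) multiset set). M2 \<omega>)"

text \<open>\<open>u \<otimes> v = u v\<^sup>T\<close>; the index type \<open>1\<close> makes the factors a \<open>d \<times> 1\<close> and a \<open>1 \<times> d\<close> matrix.\<close>

definition outer :: "real ^ 'd \<Rightarrow> real ^ 'd \<Rightarrow> real ^ 'd ^ 'd" where
  "outer u v = (columnvector u :: real ^ 1 ^ 'd) ** (rowvector v :: real ^ 'd ^ 1)"

definition isotropic :: "(real ^ 'd) multiset \<Rightarrow> bool" where
  "isotropic \<omega> \<longleftrightarrow> set_mset \<omega> \<subseteq> sphere 0 1 \<and>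
     (\<Sum>u\<in>#\<omega>. outer u u) = (real (size \<omega>) / real CARD('d)) *\<^sub>R mat 1"

lemma M2_attained_aux:
  fixes \<omega> :: "(real ^ 'd) multiset"
  shows "\<exists>v\<in>sphere 0 1. \<forall>w\<in>sphere 0 1. (\<Sum>u\<in>#\<omega>. (w \<bullet> u)\<^sup>2)
    \<le> (\<Sum>u\<in>#\<omega>. (v \<bullet> u)\<^sup>2)"
proof -
  have "continuous_on (sphere 0 1) (\<lambda>v. \<Sum>u\<in>#\<omega>. (v \<bullet> u)\<^sup>2)"
    by (induction \<omega>) (auto intro!: continuous_intros)
  moreover have "(sphere 0 1 :: (real ^ 'd) set) \<noteq> {}"
    by simp
  ultimately show ?thesis
    by (intro continuous_attains_sup compact_sphere)
qed

lemma M2_attained: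
  fixes \<omega> :: "(real ^ 'd) multiset"
  shows "\<exists>v\<in>sphere 0 1. M2 \<omega> = (\<Sum>u\<in>#\<omega>. (v \<bullet> u)\<^sup>2)"
proof -
  obtain v where v: "v \<in> sphere 0 1"
    "\<And>w. w \<in> sphere 0 1 \<Longrightarrow> (\<Sum>u\<in>#\<omega>. (w \<bullet> u)\<^sup>2) \<le> (\<Sum>u\<in>#\<omega>. (v \<bullet> u)\<^sup>2)"
    using M2_attained_aux[of \<omega>] by blast
  have "M2 \<omega> = (\<Sum>u\<in>#\<omega>. (v \<bullet> u)\<^sup>2)"
    unfolding M2_def
  proof (rule cSup_eq_maximum)
    show "(\<Sum>u\<in>#\<omega>. (v \<bullet> u)\<^sup>2) \<in> (\<lambda>v. \<Sum>u\<in>#\<omega>. (v \<bullet> u)\<^sup>2) ` sphere 0 1"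
      using v(1) by (rule imageI)
    show "x \<le> (\<Sum>u\<in>#\<omega>. (v \<bullet> u)\<^sup>2)"
      if "x \<in> (\<lambda>v. \<Sum>u\<in>#\<omega>. (v \<bullet> u)\<^sup>2) ` sphere 0 1" for x
      using that v(2) by (elim imageE) simp
  qed
  with v(1) show ?thesis by blast
qed

lemma M2_upper:
  fixes \<omega> :: "(real ^ 'd) multiset"
  assumes "v \<in> sphere 0 1"
  shows "(\<Sum>u\<in>#\<omega>. (v \<bullet> u)\<^sup>2) \<le> M2 \<omega>"
proof -
  obtain z where z: "z \<in> sphere 0 1"
    "\<And>w. w \<in> sphere 0 1 \<Longrightarrow> (\<Sum>u\<in>#\<omega>. (w \<bullet> u)\<^sup>2) \<le> (\<Sum>u\<in>#\<omega>. (z \<bullet> u)\<^sup>2)"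
    using M2_attained_aux[of \<omega>] by blast
  have "bdd_above ((\<lambda>v. \<Sum>u\<in>#\<omega>. (v \<bullet> u)\<^sup>2) ` sphere 0 1)"
    using z(2) by (rule bdd_aboveI2)
  then show ?thesis
    unfolding M2_def using assms by (intro cSUP_upper)
qed

end

theory Submission
  imports Defs
begin

text \<open>The trace of \<open>\<Sum>u \<otimes> u\<close> is \<open>n\<close>, so the quadratic form \<open>Q v = \<Sum>\<langle>v, u\<rangle>\<^sup>2\<close> has mean
  \<open>n / d\<close> over an orthonormal basis, whence the lower bound. If \<open>Q\<close> is bounded by \<open>n / d\<close> on the
  sphere, its diagonal entries all equal \<open>n / d\<close>, and evaluating \<open>Q\<close> at \<open>e\<^sub>i \<plusminus> e\<^sub>j\<close> shows that its
  off-diagonal entries vanish. For existence, start with the vectors \<open>\<surd>(n / d) e\<^sub>i\<close> together with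
  \<open>n - d\<close> zero vectors. Rotating a pair \<open>(x, y)\<close> into
  \<open>(cos t x + sin t y, cos t y - sin t x)\<close> preserves \<open>\<Sum>u \<otimes> u\<close>, and if \<open>\<bar>x\<bar> < 1 < \<bar>y\<bar>\<close> some
  angle makes the first vector a unit vector; repeating this makes all vectors unit.\<close>

lemma outer_nth [simp]: "outer u v $ i $ j = u $ i * v $ j"
  by (simp add: outer_def matrix_matrix_mult_def columnvector_def rowvector_def)

lemma sum_mset_nth_nth:
  fixes f :: "'a \<Rightarrow> real ^ 'm ^ 'n"
  shows "(\<Sum>u\<in>#\<omega>. f u) $ i $ j = (\<Sum>u\<in>#\<omega>. f u $ i $ j)"
  by (induction \<omega>) auto

lemma inner_outer_mult_vector: "v \<bullet> (outer u u *v v) = (v \<bullet> u)\<^sup>2"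
proof -
  have "outer u u *v v = (v \<bullet> u) *\<^sub>R u"
    by (simp add: vec_eq_iff matrix_vector_mult_def inner_vec_def
        sum_distrib_left mult_ac)
  then show ?thesis
    by (simp add: power2_eq_square)
qed

lemma inner_sum_outer_mult_vector:
  "v \<bullet> ((\<Sum>u\<in>#\<omega>. outer u u) *v v) = (\<Sum>u\<in>#\<omega>. (v \<bullet> u)\<^sup>2)"
  by (induction \<omega>)
    (simp_all add: matrix_vector_mult_add_rdistrib inner_add_right inner_outer_mult_vector)

text \<open>Parseval in the standard basis, summed over \<open>\<omega>\<close>; the left side is
  the trace of the sum of the outer products.\<close>

lemma sum_mset_inner_axis_power2:
  fixes \<omega> :: "(real ^ 'd) multiset"
  shows "(\<Sum>i\<in>UNIV. \<Sum>u\<in>#\<omega>. (axis i 1 \<bullet> u)\<^sup>2) = (\<Sum>u\<in>#\<omega>. (norm u)\<^sup>2)"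
proof (induction \<omega>)
  case (add u \<omega>)
  have "(\<Sum>i\<in>UNIV. (u $ i)\<^sup>2) = (norm u)\<^sup>2"
    unfolding power2_norm_eq_inner inner_vec_def by (simp add: power2_eq_square)
  with add show ?case
    by (simp add: sum.distrib inner_axis')
qed simp

lemma sum_mset_norm_power2_sphere:
  assumes "set_mset \<omega> \<subseteq> sphere 0 1"
  shows "(\<Sum>u\<in>#\<omega>. (norm u)\<^sup>2) = real (size \<omega>)"
  using assms by (induction \<omega>) auto

lemma M2_lower_bound:
  fixes \<omega> :: "(real ^ 'd) multiset"
  assumes "set_mset \<omega> \<subseteq> sphere 0 1"
  shows "real (size \<omega>) / real CARD('d) \<le> M2 \<omega>"
proof -
  have "real (size \<omega>) = (\<Sum>i\<in>(UNIV :: 'd set). \<Sum>u\<in>#\<omega>. (axis i 1 \<bullet> u)\<^sup>2)"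
    using assms by (simp add: sum_mset_inner_axis_power2 sum_mset_norm_power2_sphere)
  also have "\<dots> \<le> (\<Sum>i\<in>(UNIV :: 'd set). M2 \<omega>)"
    by (intro sum_mono M2_upper) simp
  finally show ?thesis
    by (simp add: field_simps)
qed

text \<open>Both sides are homogeneous of degree 2 in \<open>v\<close>, so the bound on the sphere
  extends to all vectors. This allows evaluation at sums of basis vectors without normalizing
  them.\<close>

lemma sum_mset_inner_power2_le_M2:
  fixes \<omega> :: "(real ^ 'd) multiset"
  shows "(\<Sum>u\<in>#\<omega>. (v \<bullet> u)\<^sup>2) \<le> M2 \<omega> * (norm v)\<^sup>2"
proof (cases "v = 0")
  case False
  have "(\<Sum>u\<in>#\<omega>. (v \<bullet> u)\<^sup>2) = (norm v)\<^sup>2 * (\<Sum>u\<in>#\<omega>. (sgn v \<bullet> u)\<^sup>2)"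
    using False
    by (auto simp: sum_mset_distrib_left sgn_div_norm field_simps
        intro!: arg_cong[where f = sum_mset] image_mset_cong)
  also have "\<dots> \<le> (norm v)\<^sup>2 * M2 \<omega>"
    using False by (intro mult_left_mono M2_upper) (auto simp: norm_sgn)
  finally show ?thesis
    by (simp add: mult.commute)
qed simp

lemma isotropic_if_M2_eq:
  fixes \<omega> :: "(real ^ 'd) multiset"
  assumes sphere: "set_mset \<omega> \<subseteq> sphere 0 1"
    and M2: "M2 \<omega> = real (size \<omega>) / real CARD('d)"
  shows "isotropic \<omega>"
proof -
  define B where "B i j = (\<Sum>u\<in>#\<omega>. u $ i * u $ j)" for i j
  have diag_le: "B i i \<le> M2 \<omega>" for i
    using M2_upper[of "axis i 1" \<omega>] by (simp add: B_def inner_axis' power2_eq_square)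
  \<comment> \<open>The deficits \<open>M2 \<omega> - B i i\<close> are nonnegative and sum to d *
    (n / d) - n, so each of them vanishes.\<close>
  have "(\<Sum>i\<in>UNIV. M2 \<omega> - B i i) = 0"
    using sum_mset_inner_axis_power2[of \<omega>] sum_mset_norm_power2_sphere[OF sphere]
    by (simp add: sum_subtractf M2 B_def inner_axis' power2_eq_square)
  then have diag: "B i i = M2 \<omega>" for i
    using diag_le by (subst (asm) sum_nonneg_eq_0_iff) auto
  have off_diag: "B i j = 0" if "i \<noteq> j" for i j
  proof -
    have "(\<Sum>u\<in>#\<omega>. ((axis i 1 + s *\<^sub>R axis j 1) \<bullet> u)\<^sup>2) = B i i + 2 * s * B i j + s\<^sup>2 * B j j" for s
      unfolding B_def
      by (induction \<omega>) (simp_all add: inner_add_left inner_axis' power2_eq_square algebra_simps)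
    moreover have "(norm (axis i 1 + s *\<^sub>R axis j 1 :: real ^ 'd))\<^sup>2 = 1 + s\<^sup>2" for s
      using that unfolding power2_norm_eq_inner
      by (simp add: inner_add_left inner_add_right inner_axis_axis power2_eq_square)
    ultimately have "B i i + 2 * s * B i j + s\<^sup>2 * B j j \<le> M2 \<omega> * (1 + s\<^sup>2)" for s
      using sum_mset_inner_power2_le_M2[of "axis i 1 + s *\<^sub>R axis j 1" \<omega>] by simp
    \<comment> \<open>As both diagonal entries equal \<open>M2 \<omega>\<close>, the inequality
      reduces to \<open>s * B i j \<le> 0\<close>; the two signs of \<open>s\<close> force
      equality.\<close>
    from this[of 1] this[of "- 1"] show ?thesis
      by (simp add: diag)
  qed
  have "(\<Sum>u\<in>#\<omega>. outer u u) = M2 \<omega> *\<^sub>R mat 1"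
    using diag off_diag by (auto simp: vec_eq_iff sum_mset_nth_nth mat_def B_def)
  with sphere show ?thesis
    by (simp add: isotropic_def M2)
qed

text \<open>Isotropy makes the quadratic form constant on the sphere, so its value at a maximizer is
  that constant.\<close>

lemma M2_isotropic:
  fixes \<omega> :: "(real ^ 'd) multiset"
  assumes "isotropic \<omega>"
  shows "M2 \<omega> = real (size \<omega>) / real CARD('d)"
proof -
  obtain v where v: "v \<in> sphere 0 1" "M2 \<omega> = (\<Sum>u\<in>#\<omega>. (v \<bullet> u)\<^sup>2)"
    using M2_attained by blast
  have "M2 \<omega> = v \<bullet> (((real (size \<omega>) / real CARD('d)) *\<^sub>R mat 1) *v v)"
    using assms v(2) by (simp add: isotropic_def flip: inner_sum_outer_mult_vector)
  also have "\<dots> = real (size \<omega>) / real CARD('d) * (norm v)\<^sup>2"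
    by (simp add: power2_norm_eq_inner flip: scaleR_matrix_vector_assoc)
  finally show ?thesis
    using v(1) by simp
qed

lemma rotate_to_unit:
  fixes x y :: "real ^ 'd"
  assumes "norm x < 1" "norm y > 1"
  obtains x' y' where "norm x' = 1" "outer x' x' + outer y' y' = outer x x + outer y y"
    "(norm x')\<^sup>2 + (norm y')\<^sup>2 = (norm x)\<^sup>2 + (norm y)\<^sup>2"
proof -
  \<comment> \<open>The norm is below 1 at t = 0, where the vector is \<open>x\<close>, and above 1
    at t = pi / 2, where it is \<open>y\<close>.\<close>
  have "\<exists>t\<ge>0. t \<le> pi / 2 \<and> norm (cos t *\<^sub>R x + sin t *\<^sub>R y) = 1"
    using assms by (intro IVT') (auto intro!: continuous_intros)
  then obtain t where t: "norm (cos t *\<^sub>R x + sin t *\<^sub>R y) = 1"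
    by blast
  define c s where "c = cos t" and "s = sin t"
  have cs: "c\<^sup>2 + s\<^sup>2 = 1"
    by (simp add: c_def s_def)
  define x' y' where "x' = c *\<^sub>R x + s *\<^sub>R y" and "y' = c *\<^sub>R y - s *\<^sub>R x"
  have "x' $ i * x' $ j + y' $ i * y' $ j = (c\<^sup>2 + s\<^sup>2) * (x $ i * x $ j + y $ i * y $ j)" for i j
    by (simp add: x'_def y'_def algebra_simps power2_eq_square)
  then have *: "x' $ i * x' $ j + y' $ i * y' $ j = x $ i * x $ j + y $ i * y $ j" for i j
    by (simp add: cs)
  show thesis
  proof
    show "norm x' = 1"
      using t by (simp add: x'_def c_def s_def)
    show "outer x' x' + outer y' y' = outer x x + outer y y"
      by (simp add: vec_eq_iff *)
    \<comment> \<open>This is the trace of the previous identity: set j = i in \<open>*\<close> and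
      sum over i.\<close>
    show "(norm x')\<^sup>2 + (norm y')\<^sup>2 = (norm x)\<^sup>2 + (norm y)\<^sup>2"
      by (simp add: power2_norm_eq_inner inner_vec_def * flip: sum.distrib)
  qed
qed

text \<open>The elements other than \<open>x\<close> contribute at most
  \<open>size \<omega> - 1\<close>, which leaves at least 1 for \<open>f x\<close>.\<close>

lemma sum_mset_eq_size_imp_all_eq_1:
  fixes f :: "'a \<Rightarrow> real"
  assumes "\<And>x. x \<in># \<omega> \<Longrightarrow> f x \<le> 1" "(\<Sum>x\<in>#\<omega>. f x) = real (size \<omega>)" "x \<in># \<omega>"
  shows "f x = 1"
proof -
  obtain \<omega>' where \<omega>: "\<omega> = add_mset x \<omega>'"
    using assms(3) by (metis mset_add)
  have "(\<Sum>x\<in>#\<omega>'. f x) \<le> (\<Sum>x\<in>#\<omega>'. 1)"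
    using assms(1) by (intro sum_mset_mono) (auto simp: \<omega>)
  then show ?thesis
    using assms(1)[of x] assms(2) by (auto simp: \<omega>)
qed

text \<open>The induction is on the size: each rotation produces one unit vector, which is set
  aside. Its partner may have any norm and returns to the remaining vectors.\<close>

lemma exists_unit_vectors_same_sum_outer:
  fixes \<omega> :: "(real ^ 'd) multiset"
  assumes "(\<Sum>u\<in>#\<omega>. (norm u)\<^sup>2) = real (size \<omega>)"
  shows "\<exists>\<omega>'. size \<omega>' = size \<omega> \<and> set_mset \<omega>' \<subseteq> sphere 0 1 \<and>
    (\<Sum>u\<in>#\<omega>'. outer u u) = (\<Sum>u\<in>#\<omega>. outer u u)"
  using assms
proof (induction "size \<omega>" arbitrary: \<omega> rule: less_induct)
  case less
  show ?case
  proof (cases "set_mset \<omega> \<subseteq> sphere 0 1")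
    case False
    then obtain z where z: "z \<in># \<omega>" "(norm z)\<^sup>2 \<noteq> 1"
      by (auto simp: abs_square_eq_1 subset_iff)
    \<comment> \<open>Squared norms with mean 1 and none above 1 would all equal 1, contrary to the
      choice of \<open>z\<close>.\<close>
    have "\<exists>y. y \<in># \<omega> \<and> (norm y)\<^sup>2 > 1"
      using sum_mset_eq_size_imp_all_eq_1[of \<omega> "\<lambda>u. (norm u)\<^sup>2" z] less.prems z
      by (meson not_le)
    then obtain y where y: "y \<in># \<omega>" "norm y > 1"
      by (metis norm_ge_zero not_le power_le_one)
    have "\<exists>x. x \<in># \<omega> \<and> (norm x)\<^sup>2 < 1"
    proof (rule ccontr)
      assume "\<not> ?thesis"
      \<comment> \<open>Reflecting the squared norms about 1 keeps their mean and turns the lower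
        bound 1 into an upper bound.\<close>
      moreover have "(\<Sum>u\<in>#\<omega>. 2 - (norm u)\<^sup>2) = 2 * real (size \<omega>) - (\<Sum>u\<in>#\<omega>. (norm u)\<^sup>2)"
        by (induction \<omega>) auto
      ultimately have "2 - (norm z)\<^sup>2 = 1"
        using less.prems z
        by (intro sum_mset_eq_size_imp_all_eq_1[of \<omega> "\<lambda>u. 2 - (norm u)\<^sup>2" z])
          (auto simp: not_less)
      with z show False
        by simp
    qed
    then obtain x where x: "x \<in># \<omega>" "norm x < 1"
      by (metis not_le one_le_power)
    obtain \<rho> where \<omega>: "\<omega> = add_mset x (add_mset y \<rho>)"
      using x y by (metis insert_noteq_member less_asym mset_add)
    obtain x' y' where xy': "norm x' = 1" "outer x' x' + outer y' y' = outer x x + outer y y"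
      "(norm x')\<^sup>2 + (norm y')\<^sup>2 = (norm x)\<^sup>2 + (norm y)\<^sup>2"
      using rotate_to_unit[OF x(2) y(2)] .
    \<comment> \<open>Setting aside the unit vector \<open>x'\<close> lowers both the total of the
      squared norms and the size by one.\<close>
    have "(\<Sum>u\<in>#add_mset y' \<rho>. (norm u)\<^sup>2) = real (size (add_mset y' \<rho>))"
      using less.prems xy' by (simp add: \<omega>)
    then obtain \<omega>' where \<omega>': "size \<omega>' = size (add_mset y' \<rho>)" "set_mset \<omega>' \<subseteq> sphere 0 1"
      "(\<Sum>u\<in>#\<omega>'. outer u u) = (\<Sum>u\<in>#add_mset y' \<rho>. outer u u)"
      using less.hyps[of "add_mset y' \<rho>"] by (auto simp: \<omega>)
    have "(\<Sum>u\<in>#add_mset x' \<omega>'. outer u u) = (\<Sum>u\<in>#\<omega>. outer u u)"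
      using xy'(2) by (simp add: \<omega>' \<omega> flip: add.assoc)
    with \<omega>' xy'(1) show ?thesis
      by (intro exI[of _ "add_mset x' \<omega>'"]) (simp add: \<omega>)
  qed blast
qed

lemma exists_isotropic:
  assumes "n \<ge> CARD('d::finite)"
  shows "\<exists>\<omega> :: (real ^ 'd) multiset. size \<omega> = n \<and> isotropic \<omega>"
proof -
  define c where "c = real n / real CARD('d)"
  \<comment> \<open>The scaling gives squared norms with total d * c = n. The subtraction is on
    naturals, so the size is n only because n is at least d.\<close>
  define \<omega> :: "(real ^ 'd) multiset" where
    "\<omega> = image_mset (\<lambda>i. axis i (sqrt c)) (mset_set UNIV) + replicate_mset (n - CARD('d)) 0"
  have size: "size \<omega> = n"
    using assms by (simp add: \<omega>_def)
  have c: "c \<ge> 0"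
    by (simp add: c_def)
  have "(\<Sum>u\<in>#\<omega>. (norm u)\<^sup>2) = (\<Sum>i\<in>(UNIV :: 'd set). c)"
    using c by (simp add: \<omega>_def image_mset.compositionality comp_def power2_norm_eq_inner
        inner_axis_axis sum_unfold_sum_mset)
  then have "(\<Sum>u\<in>#\<omega>. (norm u)\<^sup>2) = real (size \<omega>)"
    by (simp add: size c_def)
  moreover have "(\<Sum>u\<in>#\<omega>. outer u u) = c *\<^sub>R mat 1"
  proof -
    have "(\<Sum>u\<in>#\<omega>. outer u u) = (\<Sum>k\<in>UNIV. outer (axis k (sqrt c)) (axis k (sqrt c)))"
      by (simp add: \<omega>_def image_mset.compositionality comp_def sum_unfold_sum_mset
          vec_eq_iff sum_mset_nth_nth)
    also have "\<dots> = c *\<^sub>R mat 1"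
    proof -
      have "(\<Sum>k\<in>UNIV. axis k (sqrt c) $ i * axis k (sqrt c) $ j) = (if i = j then c else 0)"
        for i j :: 'd
      proof -
        \<comment> \<open>A summand survives only for k = i = j, where it is the square of
          \<open>sqrt c\<close>.\<close>
        have "(\<Sum>k\<in>UNIV. axis k (sqrt c) $ i * axis k (sqrt c) $ j)
            = (\<Sum>k\<in>UNIV. if k = i then (if i = j then c else 0) else 0)"
          using c by (intro sum.cong) (auto simp: axis_def)
        then show ?thesis
          by simp
      qed
      then show ?thesis
        by (simp add: vec_eq_iff mat_def)
    qed
    finally show ?thesis .
  qed
  ultimately show ?thesis
    using exists_unit_vectors_same_sum_outer[of \<omega>] unfolding isotropic_def
    by (metis c_def size)
qed

theorem theorem2:
  fixes n :: nat
  assumes "n \<ge> CARD('d::finite)"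
  shows "M2_min TYPE('d) n = real n / real CARD('d)
    \<and> (\<exists>\<omega> \<in> (configs n :: (real ^ 'd) multiset set). M2 \<omega> = M2_min TYPE('d) n)
    \<and> {\<omega> \<in> (configs n :: (real ^ 'd) multiset set). M2 \<omega> = M2_min TYPE('d) n}
        = {\<omega>. size \<omega> = n \<and> isotropic \<omega>}"
proof -
  obtain \<omega> :: "(real ^ 'd) multiset" where \<omega>: "size \<omega> = n" "isotropic \<omega>"
    using exists_isotropic[OF assms] by blast
  have in_configs: "\<omega> \<in> configs n"
    using \<omega> by (simp add: configs_def isotropic_def)
  have M2: "M2 \<omega> = real n / real CARD('d)"
    using M2_isotropic[OF \<omega>(2)] \<omega>(1) by simp
  have min: "M2_min TYPE('d) n = real n / real CARD('d)"
    unfolding M2_min_def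
  proof (rule cInf_eq_minimum)
    show "real n / real CARD('d) \<in> M2 ` (configs n :: (real ^ 'd) multiset set)"
      using in_configs M2 by (metis imageI)
    show "real n / real CARD('d) \<le> m" if "m \<in> M2 ` (configs n :: (real ^ 'd) multiset set)" for m
      using that M2_lower_bound by (auto simp: configs_def)
  qed
  have "{\<omega> \<in> (configs n :: (real ^ 'd) multiset set). M2 \<omega> = M2_min TYPE('d) n}
      = {\<omega>. size \<omega> = n \<and> isotropic \<omega>}"
    unfolding min by (auto simp: configs_def isotropic_if_M2_eq M2_isotropic)
      (auto simp: isotropic_def)
  with min in_configs M2 show ?thesis
    by metis
qed

end
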